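(* Every graph homomorphism from $\mathcal{PC}_6$ to $\mathcal{PC}_4$ is surjective (onto the vertex set of $\mathcal{PC}_4$).
   Context: The projective cube of dimension $d$, $\mathcal{PC}_d$, is the Cayley graph on $\mathbb{Z}_2^d$ with $u\sim v$ iff $u-v\in\{e_1,\dots,e_d,J\}$, where $e_1,\dots,e_d$ is the canonical basis and $J$ the all-ones vector. A homomorphism is a map of vertex sets sending edges to edges. *)

theory Defs
  imports "HOL-Analysis.Finite_Cartesian_Product" "HOL-Library.Z2"
begin

text \<open>A graph whose vertices are all elements of a type is given by its adjacency relation.\<close>

definition graph_hom :: "('a \<Rightarrow> 'a \<Rightarrow> bool) \<Rightarrow> ('b \<Rightarrow> 'b \<Rightarrow> bool) \<Rightarrow> ('a \<Rightarrow> 'b) \<Rightarrow> bool" where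
  "graph_hom E F f \<longleftrightarrow> (\<forall>u v. E u v \<longrightarrow> F (f u) (f v))"

definition cayley_adj :: "'a::group_add set \<Rightarrow> 'a \<Rightarrow> 'a \<Rightarrow> bool" where
  "cayley_adj S u v \<longleftrightarrow> u - v \<in> S"

text \<open>
  The type \<^typ>\<open>bit\<close> is the field with two elements, so \<^typ>\<open>bit ^ 'd\<close> is
  $\mathbb{Z}_2^d$ with $d$ the cardinality of the index type.
\<close>

definition projective_cube_adj :: "bit ^ 'd \<Rightarrow> bit ^ 'd \<Rightarrow> bool" where
  "projective_cube_adj = cayley_adj ({axis i 1 | i. True} \<union> {\<chi> i. 1})"

end

theory Submission
  imports Defs
begin

text \<open>
  \<open>PC\<^sub>d\<close> is the quotient of the cube \<open>Q\<close> of dimension \<open>d + 1\<close> by its antipodal map, and for even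
  dimensions a homomorphism lifts to a map \<open>F\<close> of cubes that commutes with the antipodal maps and
  changes exactly one coordinate along each edge, the label of the edge. Call a \<open>k\<close>-dimensional
  subcube good if the labels on it depend only on the direction and are exactly \<open>0, \<dots>, k - 1\<close>.
  A \<open>(k + 1)\<close>-dimensional subcube is good iff an odd number of its facets, counted with the value of
  coordinate \<open>k\<close> of \<open>F\<close> as weight, are good. This is Stokes' theorem for a cubical version of the
  cup product of the mod 2 cochains that detect the labels. As in the combinatorial proof of
  the Borsuk--Ulam theorem, it follows that the number of good \<open>k\<close>-cubes in half of an antipodal
  \<open>k\<close>-sphere does not depend on \<open>k\<close> modulo 2. It is 1 for \<open>k = 0\<close>, so there is a good
  subcube of the dimension of the target cube, and \<open>F\<close> maps it onto the target.
\<close>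

\<comment> \<open>These rules turn sums in \<^typ>\<open>bit\<close> into Boolean formulas, which blocks the ring normalization.\<close>
declare add_bit_eq_xor [simp del] mult_bit_eq_and [simp del]

section \<open>Sums over the field with two elements\<close>

lemma bit_add_self [simp]: "(a::bit) + a = 0"
  by (cases a) (simp_all add: add_bit_eq_xor)

lemma bit_add_eq_0_iff: "(a::bit) + b = 0 \<longleftrightarrow> a = b"
  by (cases a; cases b) auto

lemma of_nat_bit_odd: "(of_nat c :: bit) = of_bool (odd c)"
  by (induction c) auto

lemma sum_off_diagonal_swap:
  assumes "finite I"
  shows "(\<Sum>i\<in>I. \<Sum>j\<in>I - {i}. S i j) = (\<Sum>i\<in>I. \<Sum>j\<in>I - {i}. (S j i :: 'b::comm_monoid_add))"
proof -
  have "(\<Sum>i\<in>I. \<Sum>j\<in>I - {i}. S i j) = (\<Sum>i\<in>I. \<Sum>j\<in>{j\<in>I. i \<noteq> j}. S i j)"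
    by (intro sum.cong) auto
  also have "\<dots> = (\<Sum>j\<in>I. \<Sum>i\<in>{i\<in>I. i \<noteq> j}. S i j)"
    by (rule sum.swap_restrict) (use assms in auto)
  also have "\<dots> = (\<Sum>i\<in>I. \<Sum>j\<in>I - {i}. S j i)"
    by (intro sum.cong) auto
  finally show ?thesis .
qed

lemma sum_off_diagonal_symmetric_bit:
  fixes S :: "'a \<Rightarrow> 'a \<Rightarrow> bit"
  assumes "finite I" and "\<And>i j. i \<in> I \<Longrightarrow> j \<in> I \<Longrightarrow> i \<noteq> j \<Longrightarrow> S i j = S j i"
  shows "(\<Sum>i\<in>I. \<Sum>j\<in>I - {i}. S i j) = 0"
  using assms
proof (induction I rule: finite_induct)
  case (insert a I)
  have "(\<Sum>i\<in>insert a I. \<Sum>j\<in>insert a I - {i}. S i j)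
      = (\<Sum>j\<in>I. S a j) + (\<Sum>i\<in>I. \<Sum>j\<in>insert a I - {i}. S i j)"
    using insert.hyps by (simp add: insert_Diff_if)
  also have "(\<Sum>i\<in>I. \<Sum>j\<in>insert a I - {i}. S i j) = (\<Sum>i\<in>I. S i a + (\<Sum>j\<in>I - {i}. S i j))"
  proof (rule sum.cong[OF refl])
    fix i assume "i \<in> I"
    then have "insert a I - {i} = insert a (I - {i})"
      using insert.hyps by auto
    then show "(\<Sum>j\<in>insert a I - {i}. S i j) = S i a + (\<Sum>j\<in>I - {i}. S i j)"
      using insert.hyps by simp
  qed
  also have "\<dots> = (\<Sum>i\<in>I. S i a) + (\<Sum>i\<in>I. \<Sum>j\<in>I - {i}. S i j)"
    by (rule sum.distrib)
  also have "(\<Sum>i\<in>I. \<Sum>j\<in>I - {i}. S i j) = 0"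
    using insert.prems by (intro insert.IH) auto
  also have "(\<Sum>i\<in>I. S i a) = (\<Sum>i\<in>I. S a i)"
    using insert.prems insert.hyps by (intro sum.cong) auto
  finally show ?case
    by simp
qed simp

lemma sum_telescope_bit: "(\<Sum>i<n. g i + g (Suc i)) = (g 0 + g n :: bit)"
proof (induction n)
  case (Suc n)
  then show ?case
    by (cases "g n") (auto simp: algebra_simps)
qed simp

text \<open>The bijection (\<open>I\<close>, \<open>i\<close>) to (\<open>I - {i}\<close>,
  \<open>i\<close>) turns a sum over cubes and their facets into one over facets and the directions
  extending them.\<close>

lemma sum_insert_remove_swap:
  assumes "finite N"
  shows "(\<Sum>I\<in>Pow N. \<Sum>i\<in>I. h I i) = (\<Sum>J\<in>Pow N. \<Sum>i\<in>N - J. (h (insert i J) i :: 'b::comm_monoid_add))"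
proof -
  have "(\<Sum>I\<in>Pow N. \<Sum>i\<in>I. h I i) = (\<Sum>(I, i)\<in>Sigma (Pow N) (\<lambda>I. I). h I i)"
    by (rule sum.Sigma) (use assms in \<open>auto intro: finite_subset\<close>)
  also have "\<dots> = (\<Sum>(J, i)\<in>Sigma (Pow N) (\<lambda>J. N - J). h (insert i J) i)"
    by (rule sum.reindex_bij_witness[of _ "\<lambda>(J, i). (insert i J, i)" "\<lambda>(I, i). (I - {i}, i)"])
      (auto simp: insert_absorb)
  also have "\<dots> = (\<Sum>J\<in>Pow N. \<Sum>i\<in>N - J. h (insert i J) i)"
    by (rule sum.Sigma[symmetric]) (use assms in auto)
  finally show ?thesis .
qed

section \<open>Antipodal maps between cubes\<close>

locale antipodal_cube_map =
  fixes n m :: nat and F :: "nat set \<Rightarrow> nat \<Rightarrow> bit" and L :: "nat set \<Rightarrow> nat \<Rightarrow> nat"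
  assumes label_less: "x \<subseteq> {..<n} \<Longrightarrow> i < n \<Longrightarrow> i \<notin> x \<Longrightarrow> L x i < m"
    and step: "x \<subseteq> {..<n} \<Longrightarrow> i < n \<Longrightarrow> i \<notin> x \<Longrightarrow> l < m \<Longrightarrow>
      F (insert i x) l = F x l + of_bool (L x i = l)"
    and antipode: "x \<subseteq> {..<n} \<Longrightarrow> l < m \<Longrightarrow> F ({..<n} - x) l = F x l + 1"
begin

text \<open>A vertex is the set of its nonzero coordinates. The vertices of this cube are the sets
  \<open>x \<union> A\<close> with \<open>A \<subseteq> I\<close>.\<close>

definition cube :: "nat set \<Rightarrow> nat set \<Rightarrow> bool" where
  "cube x I \<longleftrightarrow> x \<union> I \<subseteq> {..<n} \<and> x \<inter> I = {}"

lemma cubeD: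
  assumes "cube x I" "A \<subseteq> I" "d \<in> I" "d \<notin> A"
  shows "x \<union> A \<subseteq> {..<n}" "d < n" "d \<notin> x \<union> A"
  using assms by (auto simp: cube_def)

lemma cube_finite: "cube x I \<Longrightarrow> finite I"
  by (auto simp: cube_def intro: finite_subset)

lemma cube_insert: "cube x I \<Longrightarrow> i \<in> I \<Longrightarrow> cube (insert i x) (I - {i})"
  by (auto simp: cube_def)

lemma cube_remove: "cube x I \<Longrightarrow> cube x (I - {i})"
  by (auto simp: cube_def)

definition good :: "nat \<Rightarrow> nat set \<Rightarrow> nat set \<Rightarrow> bool" where
  "good k x I \<longleftrightarrow> bij_betw (L x) I {..<k} \<and> (\<forall>A d. A \<subseteq> I \<longrightarrow> d \<in> I - A \<longrightarrow> L (x \<union> A) d = L x d)"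

lemma goodI:
  assumes "bij_betw p I {..<k}" "\<And>A d. A \<subseteq> I \<Longrightarrow> d \<in> I \<Longrightarrow> d \<notin> A \<Longrightarrow> L (x \<union> A) d = p d"
  shows "good k x I"
proof -
  have "L x d = p d" if "d \<in> I" for d
    using assms(2)[of "{}" d] that by simp
  then show ?thesis
    using assms by (auto simp: good_def cong: bij_betw_cong)
qed

lemma goodD: "good k x I \<Longrightarrow> A \<subseteq> I \<Longrightarrow> d \<in> I \<Longrightarrow> d \<notin> A \<Longrightarrow> L (x \<union> A) d = L x d"
  by (auto simp: good_def)

section \<open>Parity criterion for good subcubes\<close>

text \<open>Both ways around the square end at the same vertex, so the four labels cancel modulo 2
  and must pair up.\<close>

lemma square:
  assumes "x \<subseteq> {..<n}" "i < n" "j < n" "i \<noteq> j" "i \<notin> x" "j \<notin> x"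
  shows "(L x i = L (insert i x) j \<and> L x j = L (insert j x) i) \<or>
    (L x i = L x j \<and> L (insert i x) j = L (insert j x) i) \<or>
    (L x i = L (insert j x) i \<and> L (insert i x) j = L x j)"
proof -
  let ?a = "L x i" and ?b = "L (insert i x) j" and ?c = "L x j" and ?d = "L (insert j x) i"
  have lt: "?a < m" "?b < m" "?c < m" "?d < m"
    using assms by (auto intro!: label_less)
  have eq: "of_bool (?a = l) + of_bool (?b = l) = (of_bool (?c = l) + of_bool (?d = l) :: bit)"
    if "l < m" for l
  proof -
    have "F (insert j (insert i x)) l = F x l + of_bool (?a = l) + of_bool (?b = l)"
      using assms that by (simp add: step)
    moreover have "F (insert i (insert j x)) l = F x l + of_bool (?c = l) + of_bool (?d = l)"
      using assms that by (simp add: step)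
    ultimately show ?thesis
      unfolding add.assoc insert_commute[of i j] by (simp del: of_bool_eq_iff)
  qed
  show ?thesis
    using eq[OF lt(1)] eq[OF lt(2)] eq[OF lt(3)] eq[OF lt(4)]
    by (auto split: if_splits simp: of_bool_def)
qed

text \<open>In a good cube only the direction labelled \<open>k\<close> counts. Conversely, a
  counted direction forces a good cube or exactly one further counted direction, and an odd count
  excludes the latter.\<close>

lemma good_Suc_iff_odd:
  assumes cube: "cube x I"
  shows "good (Suc k) x I \<longleftrightarrow> odd (card {i\<in>I. L x i = k \<and> good k (insert i x) (I - {i})})"
    (is "_ \<longleftrightarrow> odd (card ?R)")
proof
  assume good: "good (Suc k) x I"
  then have bij: "bij_betw (L x) I {..<Suc k}"
    and const: "\<And>A d. A \<subseteq> I \<Longrightarrow> d \<in> I - A \<Longrightarrow> L (x \<union> A) d = L x d"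
    by (auto simp: good_def)
  obtain i where i: "i \<in> I" "L x i = k"
    using bij by (metis bij_betw_iff_bijections lessThan_iff lessI)
  have "bij_betw (L x) (I - {i}) ({..<Suc k} - {k})"
    using bij i by (metis bij_betw_DiffI bij_betw_singletonI singletonI empty_subsetI insert_subset lessI lessThan_iff)
  moreover have "{..<Suc k} - {k} = {..<k}"
    by auto
  moreover have "L (insert i x \<union> A) d = L x d" if "A \<subseteq> I - {i}" "d \<in> I - {i}" "d \<notin> A" for A d
    using const[of "insert i A" d] that i by (auto simp: subset_Diff_insert)
  ultimately have "good k (insert i x) (I - {i})"
    by (intro goodI[where p = "L x"]) auto
  then have "?R = {i}"
    using i bij by (auto simp: bij_betw_def inj_on_def)
  then show "odd (card ?R)"
    by simp
next
  assume odd: "odd (card ?R)"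
  then have "?R \<noteq> {}"
    by (metis card.empty even_zero)
  then obtain i where i: "i \<in> I" "L x i = k" "good k (insert i x) (I - {i})"
    by auto
  define J where "J = I - {i}"
  define p where "p = L (insert i x)"
  \<comment> \<open>The label of direction \<open>i\<close> as the edge moves over the lower facet;
    only the labels of the upper facet are known so far.\<close>
  define \<mu> where "\<mu> A = L (x \<union> A) i" for A
  have I: "I = insert i J" "i \<notin> J"
    using i by (auto simp: J_def)
  have finJ: "finite J"
    using cube_finite[OF cube] by (simp add: J_def)
  have bij: "bij_betw p J {..<k}"
    and const: "\<And>A d. A \<subseteq> J \<Longrightarrow> d \<in> J \<Longrightarrow> d \<notin> A \<Longrightarrow> L (insert i (x \<union> A)) d = p d"
    using i(3) by (auto simp: good_def J_def p_def)
  have inj: "p d = p d' \<longleftrightarrow> d = d'" if "d \<in> J" "d' \<in> J" for d d'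
    using bij that by (auto simp: bij_betw_def inj_on_def)
  have less: "p d < k" if "d \<in> J" for d
    using bij that by (auto simp: bij_betw_def)
  have sq: "(\<mu> A = p d \<and> L (x \<union> A) d = \<mu> (insert d A)) \<or>
      (\<mu> A = L (x \<union> A) d \<and> p d = \<mu> (insert d A)) \<or>
      (\<mu> A = \<mu> (insert d A) \<and> p d = L (x \<union> A) d)"
    if "A \<subseteq> J" "d \<in> J" "d \<notin> A" for A d
    using square[of "x \<union> A" i d] const[of A d] cubeD[OF cube, of A d] cubeD[OF cube, of A i] that I
    by (auto simp: \<mu>_def)
  have start: "\<mu> {} = k"
    using i by (simp add: \<mu>_def)
  \<comment> \<open>Going up across \<open>d\<close>, the label of \<open>i\<close> cannot already
    be \<open>p d\<close>, so by the square relation it persists or becomes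
    \<open>p d\<close>.\<close>
  have up: "\<mu> A = k \<or> \<mu> A \<in> p ` A" if "A \<subseteq> J" for A
    using finite_subset[OF that finJ] that
  proof (induction A rule: finite_induct)
    case (insert d A)
    then have IH: "\<mu> A = k \<or> \<mu> A \<in> p ` A"
      by simp
    then have "\<mu> A \<noteq> p d"
      using insert less[of d] inj by auto
    then have "\<mu> (insert d A) = \<mu> A \<or> \<mu> (insert d A) = p d"
      using sq[of A d] insert by auto
    then show ?case
      using IH by auto
  qed (simp add: start)
  have pull: "\<mu> A = \<mu> (insert d A) \<and> L (x \<union> A) d = p d"
    if "A \<subseteq> J" "d \<in> J" "d \<notin> A" "\<mu> (insert d A) \<noteq> p d" for A d
  proof -
    have "\<mu> A \<noteq> p d"
      using up[OF that(1)] that less[of d] inj by auto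
    then show ?thesis
      using sq[of A d] that by auto
  qed
  \<comment> \<open>Going down from the top, the label of \<open>i\<close> can change only on
    crossing the direction whose \<open>p\<close>-label it carries.\<close>
  have down: "\<mu> (J - D) = \<mu> J" if "D \<subseteq> J" "\<mu> J \<notin> p ` D" for D
    using finite_subset[OF that(1) finJ] that
  proof (induction D rule: finite_induct)
    case (insert d D)
    have "insert d (J - insert d D) = J - D"
      using insert by auto
    then show ?case
      using pull[of "J - insert d D" d] insert by auto
  qed simp
  show "good (Suc k) x I"
  proof (cases "\<mu> J = k")
    case True
    have all: "\<mu> A = k" if "A \<subseteq> J" for A
    proof -
      have "\<mu> J \<notin> p ` (J - A)"
        using True less by fastforce
      then show ?thesis
        using down[of "J - A"] that True by (auto simp: double_diff)
    qed
    have lab: "L (x \<union> A) d = p d" if "A \<subseteq> J" "d \<in> J" "d \<notin> A" for A d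
      using pull[of A d] all[of "insert d A"] less[of d] that by auto
    show ?thesis
    proof (rule goodI)
      have "bij_betw (p(i := k)) J {..<k}"
        using bij I(2) by (metis bij_betw_cong fun_upd_other)
      then show "bij_betw (p(i := k)) I {..<Suc k}"
        using I by (simp add: lessThan_Suc bij_betw_def)
    next
      fix A d
      assume A: "A \<subseteq> I" "d \<in> I" "d \<notin> A"
      show "L (x \<union> A) d = (p(i := k)) d"
      proof (cases "i \<in> A")
        case True
        then have "x \<union> A = insert i (x \<union> (A - {i}))"
          by auto
        then show ?thesis
          using const[of "A - {i}" d] A I True by auto
      next
        case False
        then have "A \<subseteq> J"
          using A I by auto
        then show ?thesis
          using all[of A] lab[of A d] A I by (auto simp: \<mu>_def)
      qed
    qed
  next
    case False
    \<comment> \<open>Here the top label of direction \<open>i\<close> repeats that of a direction \<open>j\<close>; then \<open>?R = {i, j}\<close>.\<close>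
    then obtain j where j: "j \<in> J" "\<mu> J = p j"
      using up[of J] by auto
    then have ij: "i \<noteq> j" "j \<in> I"
      using I by auto
    have all: "\<mu> A = p j" if "A \<subseteq> J" "j \<in> A" for A
    proof -
      have "p j \<notin> p ` (J - A)"
        using that j inj by auto
      then show ?thesis
        using down[of "J - A"] that j by (auto simp: double_diff)
    qed
    have lab: "L (x \<union> A) d = p d" if "A \<subseteq> J" "j \<in> A" "d \<in> J" "d \<notin> A" for A d
      using pull[of A d] all[of "insert d A"] inj[of j d] j that by auto
    have "L x j = k"
      using sq[of "{}" j] all[of "{j}"] less[of j] start j by auto
    moreover have "good k (insert j x) (I - {j})"
    proof (rule goodI)
      \<comment> \<open>Beyond \<open>j\<close>, direction \<open>i\<close> has label
        \<open>p j\<close> throughout and takes the place of \<open>j\<close>.\<close>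
      let ?t = "p(i := p j)"
      have "?t ` (I - {j}) = p ` J"
        using j I ij by (auto simp: image_iff)
      moreover have "inj_on ?t (I - {j})"
        using I j inj by (auto simp: inj_on_def)
      ultimately show "bij_betw ?t (I - {j}) {..<k}"
        using bij by (simp add: bij_betw_def)
    next
      fix A d
      assume A: "A \<subseteq> I - {j}" "d \<in> I - {j}" "d \<notin> A"
      show "L (insert j x \<union> A) d = (p(i := p j)) d"
      proof (cases "i \<in> A")
        case True
        then have "insert j x \<union> A = insert i (x \<union> insert j (A - {i}))"
          by auto
        then show ?thesis
          using const[of "insert j (A - {i})" d] A I True j by auto
      next
        case False
        then have "insert j A \<subseteq> J" "insert j x \<union> A = x \<union> insert j A"
          using A I j by auto
        then show ?thesis
          using all[of "insert j A"] lab[of "insert j A" d] A I by (auto simp: \<mu>_def)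
      qed
    qed
    ultimately have jR: "j \<in> ?R"
      using ij by simp
    \<comment> \<open>Any other such facet has edges in directions \<open>i\<close> and
      \<open>j\<close> that both carry label \<open>p j\<close>.\<close>
    have "i' \<in> {i, j}" if "i' \<in> ?R" for i'
    proof (rule ccontr)
      assume n: "i' \<notin> {i, j}"
      let ?q = "L (insert i' x)"
      have g: "i' \<in> I" "inj_on ?q (I - {i'})"
        "\<And>A d. A \<subseteq> I - {i'} \<Longrightarrow> d \<in> I - {i'} \<Longrightarrow> d \<notin> A \<Longrightarrow> L (insert i' x \<union> A) d = ?q d"
        using that by (auto simp: good_def bij_betw_def)
      have e: "insert i' x \<union> (I - {i'} - {i}) = x \<union> J"
        "insert i' x \<union> (I - {i'} - {j}) = insert i (x \<union> (J - {j}))"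
        using I j g(1) n by auto
      have "?q i = p j"
        using g(3)[of "I - {i'} - {i}" i] e n i j by (auto simp: \<mu>_def)
      moreover have "?q j = p j"
        using g(3)[of "I - {i'} - {j}" j] e n ij const[of "J - {j}" j] j by auto
      ultimately show False
        using g(2) ij i n by (auto simp: inj_on_def)
    qed
    then have "?R = {i, j}"
      using jR i by auto
    then show ?thesis
      using odd ij by simp
  qed
qed

section \<open>Good cubes as a mod 2 cocycle\<close>

text \<open>This vanishes unless \<open>I\<close> has \<open>k\<close> elements, so a sum over all
  \<open>I\<close> sees only \<open>k\<close>-cubes.\<close>

definition G :: "nat \<Rightarrow> nat set \<Rightarrow> nat set \<Rightarrow> bit" where
  "G k x I = of_bool (good k x I)"

text \<open>The factor with \<open>F\<close> is the indicator of \<open>L x i = k\<close>, so the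
  sum is the parity in the criterion, written as a cup product.\<close>

lemma G_Suc:
  assumes "cube x I" "k < m"
  shows "G (Suc k) x I = (\<Sum>i\<in>I. (F x k + F (insert i x) k) * G k (insert i x) (I - {i}))"
proof -
  have "(\<Sum>i\<in>I. (F x k + F (insert i x) k) * G k (insert i x) (I - {i}))
      = (\<Sum>i\<in>I. of_bool (L x i = k \<and> good k (insert i x) (I - {i})))"
  proof (rule sum.cong[OF refl])
    fix i assume "i \<in> I"
    then have "F (insert i x) k = F x k + of_bool (L x i = k)"
      using assms by (intro step) (auto simp: cube_def)
    then show "(F x k + F (insert i x) k) * G k (insert i x) (I - {i})
        = of_bool (L x i = k \<and> good k (insert i x) (I - {i}))"
      by (cases "F x k") (auto simp: G_def)
  qed
  also have "\<dots> = of_nat (card {i\<in>I. L x i = k \<and> good k (insert i x) (I - {i})})"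
    using cube_finite[OF assms(1)] by (simp add: sum.If_cases of_bool_def Int_def)
  finally show ?thesis
    using good_Suc_iff_odd[OF assms(1), of k] by (simp add: G_def of_nat_bit_odd)
qed

lemma G_0: "G 0 x I = of_bool (I = {})"
  by (auto simp: G_def good_def bij_betw_def)

text \<open>The edge factor of the product is itself a coboundary, so the coboundary of
  \<open>G (Suc k)\<close> reduces to that of \<open>G k\<close> on the facets at
  \<open>insert j x\<close>.\<close>

lemma G_closed:
  assumes "cube x I" "k \<le> m"
  shows "(\<Sum>i\<in>I. G k x (I - {i}) + G k (insert i x) (I - {i})) = 0"
  using assms
proof (induction k arbitrary: x I)
  case 0
  then show ?case
    by (simp add: G_0)
next
  case (Suc k)
  have fin: "finite I"
    using cube_finite Suc.prems by blast
  let ?D = "\<lambda>x j. F x k + F (insert j x) k"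
  let ?A = "\<lambda>i j. ?D x j * G k (insert j x) (I - {i} - {j})"
  let ?B = "\<lambda>i j. ?D (insert i x) j * G k (insert j (insert i x)) (I - {i} - {j})"
  let ?C = "\<lambda>i j. ?D x j * G k (insert i (insert j x)) (I - {i} - {j})"
  have "(\<Sum>i\<in>I. G (Suc k) x (I - {i}) + G (Suc k) (insert i x) (I - {i}))
      = (\<Sum>i\<in>I. (\<Sum>j\<in>I - {i}. ?A i j) + (\<Sum>j\<in>I - {i}. ?B i j))"
    using Suc.prems by (intro sum.cong refl arg_cong2[where f = "(+)"] G_Suc)
      (auto intro: cube_insert cube_remove)
  also have "\<dots> = (\<Sum>i\<in>I. \<Sum>j\<in>I - {i}. ?A i j) + (\<Sum>i\<in>I. \<Sum>j\<in>I - {i}. ?B i j)"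
    by (rule sum.distrib)
  also have "(\<Sum>i\<in>I. \<Sum>j\<in>I - {i}. ?B i j) = (\<Sum>i\<in>I. \<Sum>j\<in>I - {i}. ?C i j)"
  proof -
    have "(\<Sum>i\<in>I. \<Sum>j\<in>I - {i}. ?B i j) + (\<Sum>i\<in>I. \<Sum>j\<in>I - {i}. ?C i j)
        = (\<Sum>i\<in>I. \<Sum>j\<in>I - {i}. ?B i j) + (\<Sum>i\<in>I. \<Sum>j\<in>I - {i}. ?C j i)"
      using sum_off_diagonal_swap[OF fin, of ?C] by simp
    also have "\<dots> = (\<Sum>i\<in>I. \<Sum>j\<in>I - {i}. ?B i j + ?C j i)"
      by (simp add: sum.distrib)
    also have "\<dots> = 0"
    proof (rule sum_off_diagonal_symmetric_bit[OF fin])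
      fix i j
      have e: "I - {j} - {i} = I - {i} - {j}" "insert i (insert j x) = insert j (insert i x)"
        by auto
      \<comment> \<open>The two weights telescope to the sum of \<open>F\<close> at \<open>x\<close>
        and at \<open>insert i (insert j x)\<close>, which is symmetric in \<open>i\<close> and
        \<open>j\<close>.\<close>
      show "?B i j + ?C j i = ?B j i + ?C i j"
        unfolding e distrib_right[symmetric]
        by (cases "F (insert i x) k"; cases "F (insert j x) k") (auto simp: insert_commute)
    qed
    finally show ?thesis
      by (simp add: bit_add_eq_0_iff)
  qed
  also have "(\<Sum>i\<in>I. \<Sum>j\<in>I - {i}. ?A i j) + (\<Sum>i\<in>I. \<Sum>j\<in>I - {i}. ?C i j)
      = (\<Sum>i\<in>I. \<Sum>j\<in>I - {i}. ?A i j + ?C i j)"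
    by (simp add: sum.distrib)
  also have "\<dots> = (\<Sum>j\<in>I. \<Sum>i\<in>I - {j}. ?A i j + ?C i j)"
    by (rule sum_off_diagonal_swap[OF fin])
  also have "\<dots> = (\<Sum>j\<in>I. ?D x j * (\<Sum>i\<in>I - {j}. G k (insert j x) (I - {j} - {i})
      + G k (insert i (insert j x)) (I - {j} - {i})))"
  proof -
    have "I - {i} - {j} = I - {j} - {i}" for i j
      by auto
    then show ?thesis
      by (simp add: sum_distrib_left distrib_left)
  qed
  also have "\<dots> = 0"
    using Suc.prems by (intro sum.neutral ballI) (simp add: Suc.IH cube_insert)
  finally show ?case .
qed

text \<open>The product rule for the coboundary of \<open>F\<close> times \<open>G k\<close>; the
  other term vanishes because \<open>G k\<close> is closed.\<close>

lemma stokes: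
  assumes "cube x I" "k < m"
  shows "G (Suc k) x I = (\<Sum>i\<in>I. F x k * G k x (I - {i}) + F (insert i x) k * G k (insert i x) (I - {i}))"
proof -
  have "(\<Sum>i\<in>I. F x k * G k x (I - {i}) + F (insert i x) k * G k (insert i x) (I - {i}))
      = (\<Sum>i\<in>I. (F x k + F (insert i x) k) * G k (insert i x) (I - {i})
          + F x k * (G k x (I - {i}) + G k (insert i x) (I - {i})))"
    by (intro sum.cong refl) (cases "F x k"; auto simp: algebra_simps)
  also have "\<dots> = G (Suc k) x I + F x k * (\<Sum>i\<in>I. G k x (I - {i}) + G k (insert i x) (I - {i}))"
    by (simp add: sum.distrib[where h = "\<lambda>i. F x k * _ i"] G_Suc[OF assms] sum_distrib_left)
  finally show ?thesis
    using G_closed[OF assms(1), of k] assms(2) by simp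
qed

text \<open>Each direction of a good cube flips its own coordinate, so none is flipped twice between
  \<open>x\<close> and \<open>x \<union> A\<close>.\<close>

lemma good_value:
  assumes "cube x I" "good k x I" "A \<subseteq> I" "l < m"
  shows "F (x \<union> A) l = F x l + of_bool (l \<in> L x ` A)"
  using finite_subset[OF assms(3) cube_finite[OF assms(1)]] assms(3)
proof (induction A rule: finite_induct)
  case (insert d A)
  have "L (x \<union> A) d = L x d"
    using assms(2) insert by (intro goodD) auto
  then have "F (insert d (x \<union> A)) l = F (x \<union> A) l + of_bool (L x d = l)"
    using step[of "x \<union> A" d l] cubeD[OF assms(1), of A d] assms(4) insert by simp
  moreover have "L x d \<notin> L x ` A"
    using assms(2) insert by (auto simp: good_def bij_betw_def inj_on_def)
  ultimately show ?case
    using insert by (auto simp: of_bool_def split: if_splits)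
qed simp

section \<open>Good cubes under the antipodal map\<close>

lemma antipode_label:
  assumes "x \<subseteq> {..<n}" "i < n" "i \<notin> x"
  shows "L ({..<n} - insert i x) i = L x i"
proof -
  let ?y = "{..<n} - insert i x"
  have y: "?y \<subseteq> {..<n}" "i \<notin> ?y" "insert i ?y = {..<n} - x"
    using assms by auto
  have l: "L x i < m"
    using assms by (rule label_less)
  have "F ({..<n} - x) (L x i) = F ?y (L x i) + of_bool (L ?y i = L x i)"
    using step[OF y(1) assms(2) y(2) l] y(3) by simp
  then show ?thesis
    using antipode[OF assms(1) l] antipode[of "insert i x", OF _ l] step[OF assms l] assms
    by (cases "F x (L x i)") (auto split: if_splits simp: of_bool_def)
qed

lemma good_antipode:
  assumes "cube x I" "good k x I"
  shows "good k ({..<n} - I - x) I"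
proof (rule goodI)
  show "bij_betw (L x) I {..<k}"
    using assms by (simp add: good_def)
next
  fix A d
  assume A: "A \<subseteq> I" "d \<in> I" "d \<notin> A"
  \<comment> \<open>The edge in direction \<open>d\<close> at \<open>x \<union> ?B\<close> is
    antipodal to the one in question.\<close>
  let ?B = "I - A - {d}"
  have e: "{..<n} - insert d (x \<union> ?B) = ({..<n} - I - x) \<union> A"
    using A assms(1) by (auto simp: cube_def)
  have "L ({..<n} - insert d (x \<union> ?B)) d = L (x \<union> ?B) d"
    using A assms(1) by (intro antipode_label) (auto simp: cube_def)
  also have "\<dots> = L x d"
    using A assms(2) by (intro goodD) auto
  finally show "L (({..<n} - I - x) \<union> A) d = L x d"
    unfolding e .
qed

lemma G_antipode:
  assumes "cube x I"
  shows "G k ({..<n} - I - x) I = G k x I"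
proof -
  have "cube ({..<n} - I - x) I" "{..<n} - I - ({..<n} - I - x) = x"
    using assms by (auto simp: cube_def)
  then show ?thesis
    using good_antipode[OF assms, of k] good_antipode[of "{..<n} - I - x" I k] by (auto simp: G_def)
qed

section \<open>Half spheres and invariance of the parity\<close>

text \<open>The cubes with base \<open>W I 0\<close> and directions \<open>I\<close>, \<open>card I = k\<close>, form half of an antipodal
  \<open>k\<close>-sphere: its vertices alternate between the blocks into which \<open>I\<close> cuts \<open>{..<n}\<close>.\<close>

definition W :: "nat set \<Rightarrow> nat \<Rightarrow> nat set" where
  "W J t = {a \<in> {..<n} - J. (a < t) \<noteq> odd (card {i\<in>J. a < i})}"

lemma cube_W: "J \<subseteq> {..<n} \<Longrightarrow> cube (W J t) J"
  by (auto simp: W_def cube_def)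

lemma W_n: "W J n = {..<n} - J - W J 0"
  by (auto simp: W_def)

lemma W_Suc_in: "i \<in> J \<Longrightarrow> W J (Suc i) = W J i"
  by (auto simp: W_def less_Suc_eq)

text \<open>A new direction \<open>i\<close> flips the parity below \<open>i\<close>, as does the
  threshold \<open>t = i\<close>. Hence the two facets across \<open>i\<close> are consecutive on
  the path \<open>W J 0\<close>, ..., \<open>W J n\<close>.\<close>

lemma W_insert:
  assumes "J \<subseteq> {..<n}" "i < n" "i \<notin> J"
  shows "{W (insert i J) 0, insert i (W (insert i J) 0)} = {W J i, W J (Suc i)}"
proof -
  have fin: "finite J"
    using assms finite_subset by blast
  have c: "odd (card {j\<in>insert i J. a < j}) \<longleftrightarrow> (a < i) \<noteq> odd (card {j\<in>J. a < j})" for a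
  proof (cases "a < i")
    case True
    then have "{j\<in>insert i J. a < j} = insert i {j\<in>J. a < j}"
      by auto
    then show ?thesis
      using True assms(3) fin by simp
  next
    case False
    then have "{j\<in>insert i J. a < j} = {j\<in>J. a < j}"
      by auto
    then show ?thesis
      using False by simp
  qed
  have 1: "W (insert i J) 0 = W J i - {i}"
    unfolding W_def c by auto
  have 2: "W J (Suc i) - {i} = W J i - {i}"
    by (auto simp: W_def less_Suc_eq)
  have 3: "i \<in> W J i \<longleftrightarrow> i \<notin> W J (Suc i)"
    using assms by (auto simp: W_def)
  show "{W (insert i J) 0, insert i (W (insert i J) 0)} = {W J i, W J (Suc i)}"
  proof (cases "i \<in> W J i")
    case True
    then have "W J (Suc i) = W J i - {i}" "insert i (W J i - {i}) = W J i"
      using 2 3 by auto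
    then show ?thesis
      using 1 by auto
  next
    case False
    then have "W J i - {i} = W J i" "insert i (W J i) = W J (Suc i)"
      using 2 3 by auto
    then show ?thesis
      using 1 by auto
  qed
qed

text \<open>The facets with directions \<open>J\<close> lie along a path between antipodal cubes,
  which stands still at each \<open>i\<close> in \<open>J\<close>; interior facets occur twice and
  cancel.\<close>

lemma boundary_W:
  assumes "J \<subseteq> {..<n}"
  shows "(\<Sum>i\<in>{..<n} - J. h (W (insert i J) 0) + h (insert i (W (insert i J) 0)))
    = (h (W J 0) + h (W J n) :: bit)"
proof -
  have "(\<Sum>i\<in>{..<n} - J. h (W (insert i J) 0) + h (insert i (W (insert i J) 0)))
      = (\<Sum>i\<in>{..<n} - J. h (W J i) + h (W J (Suc i)))"
  proof (rule sum.cong[OF refl])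
    fix i assume "i \<in> {..<n} - J"
    then show "h (W (insert i J) 0) + h (insert i (W (insert i J) 0)) = h (W J i) + h (W J (Suc i))"
      using W_insert[OF assms, of i] by (auto simp: doubleton_eq_iff add.commute)
  qed
  also have "\<dots> = (\<Sum>i<n. h (W J i) + h (W J (Suc i)))"
    by (intro sum.mono_neutral_left) (auto simp: W_Suc_in)
  also have "\<dots> = h (W J 0) + h (W J n)"
    by (rule sum_telescope_bit)
  finally show ?thesis .
qed

text \<open>After Stokes and cancellation, each \<open>J\<close> leaves an antipodal pair of cubes.
  If they are good, their weights differ by 1, so the pair counts once.\<close>

lemma sum_G_Suc:
  assumes "k < m"
  shows "(\<Sum>I\<in>Pow {..<n}. G (Suc k) (W I 0) I) = (\<Sum>I\<in>Pow {..<n}. G k (W I 0) I)"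
proof -
  let ?T = "\<lambda>J x. F x k * G k x J"
  have "(\<Sum>I\<in>Pow {..<n}. G (Suc k) (W I 0) I)
      = (\<Sum>I\<in>Pow {..<n}. \<Sum>i\<in>I. ?T (I - {i}) (W I 0) + ?T (I - {i}) (insert i (W I 0)))"
    using assms by (intro sum.cong refl stokes) (auto intro: cube_W)
  also have "\<dots> = (\<Sum>J\<in>Pow {..<n}. \<Sum>i\<in>{..<n} - J.
      ?T (insert i J - {i}) (W (insert i J) 0) + ?T (insert i J - {i}) (insert i (W (insert i J) 0)))"
    by (rule sum_insert_remove_swap) simp
  also have "\<dots> = (\<Sum>J\<in>Pow {..<n}. \<Sum>i\<in>{..<n} - J.
      ?T J (W (insert i J) 0) + ?T J (insert i (W (insert i J) 0)))"
    by (intro sum.cong refl) simp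
  also have "\<dots> = (\<Sum>J\<in>Pow {..<n}. ?T J (W J 0) + ?T J (W J n))"
    by (intro sum.cong refl boundary_W) auto
  also have "\<dots> = (\<Sum>J\<in>Pow {..<n}. G k (W J 0) J)"
  proof (rule sum.cong[OF refl])
    fix J assume "J \<in> Pow {..<n}"
    then have c: "cube (W J 0) J"
      by (auto intro: cube_W)
    have e: "W J n = {..<n} - (W J 0 \<union> J)"
      by (auto simp: W_n)
    \<comment> \<open>\<open>W J n\<close> is antipodal to the far corner of the cube at
      \<open>W J 0\<close>, and a good \<open>k\<close>-cube never flips coordinate
      \<open>k\<close>.\<close>
    have "F (W J n) k = F (W J 0) k + 1" if "good k (W J 0) J"
      unfolding e using antipode[of "W J 0 \<union> J" k] good_value[OF c that subset_refl assms] c assms that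
      by (auto simp: cube_def good_def bij_betw_def)
    moreover have "G k (W J n) J = G k (W J 0) J"
      using G_antipode[OF c] by (simp add: W_n)
    ultimately show "?T J (W J 0) + ?T J (W J n) = G k (W J 0) J"
      by (cases "F (W J 0) k") (auto simp: G_def)
  qed
  finally show ?thesis .
qed

lemma sum_G: "k \<le> m \<Longrightarrow> (\<Sum>I\<in>Pow {..<n}. G k (W I 0) I) = 1"
proof (induction k)
  case 0
  have "(\<Sum>I\<in>Pow {..<n}. G 0 (W I 0) I) = (\<Sum>I\<in>Pow {..<n}. if I = {} then 1 else 0)"
    by (intro sum.cong) (auto simp: G_0)
  then show ?case
    by (simp add: sum.delta)
qed (simp add: sum_G_Suc)

lemma ex_good: "\<exists>x I. cube x I \<and> good m x I"
proof (rule ccontr)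
  assume "\<nexists>x I. cube x I \<and> good m x I"
  then have "(\<Sum>I\<in>Pow {..<n}. G m (W I 0) I) = 0"
    by (intro sum.neutral ballI) (auto simp: G_def dest: cube_W)
  then show False
    using sum_G[of m] by simp
qed

lemma surjective: "\<exists>x\<subseteq>{..<n}. \<forall>l<m. F x l = y l"
proof -
  obtain x I where c: "cube x I" and g: "good m x I"
    using ex_good by blast
  \<comment> \<open>The directions whose labels are the coordinates in which \<open>F x\<close>
    differs from \<open>y\<close>.\<close>
  define A where "A = {d\<in>I. F x (L x d) \<noteq> y (L x d)}"
  have "F (x \<union> A) l = y l" if "l < m" for l
  proof -
    have "l \<in> L x ` I"
      using g that by (simp add: good_def bij_betw_def)
    then obtain d where d: "d \<in> I" "L x d = l"
      by blast
    have "l \<in> L x ` A \<longleftrightarrow> F x l \<noteq> y l"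
      using d by (auto simp: A_def)
    moreover have "A \<subseteq> I"
      by (auto simp: A_def)
    ultimately show ?thesis
      using good_value[OF c g, of A l] that by (cases "F x l"; cases "y l") simp_all
  qed
  moreover have "x \<union> A \<subseteq> {..<n}"
    using c by (auto simp: cube_def A_def)
  ultimately show ?thesis
    by blast
qed

end

section \<open>Lifting homomorphisms of projective cubes\<close>

lemma bit_vec_add_self: "(v :: bit ^ 'd) + v = 0"
  by (simp add: vec_eq_iff)

lemma bit_vec_diff: "(u :: bit ^ 'd) - v = u + v"
  by (simp add: vec_eq_iff)

lemma projective_cube_hom_surj:
  fixes f :: "bit ^ 'd \<Rightarrow> bit ^ 'e"
  assumes hom: "graph_hom projective_cube_adj projective_cube_adj f"
    and even: "even CARD('d)" "even CARD('e)"
  shows "surj f"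
proof -
  define d where "d = CARD('d)"
  define e where "e = CARD('e)"
  obtain p :: "nat \<Rightarrow> 'd" where p: "bij_betw p {..<d} UNIV"
    using ex_bij_betw_nat_finite[of "UNIV :: 'd set"] by (auto simp: d_def atLeast0LessThan)
  obtain q :: "nat \<Rightarrow> 'e" where q: "bij_betw q {..<e} UNIV"
    using ex_bij_betw_nat_finite[of "UNIV :: 'e set"] by (auto simp: e_def atLeast0LessThan)
  \<comment> \<open>Index \<open>d\<close> is the all-ones generator, so \<open>v\<close> is the
    covering by the cube of dimension \<open>d + 1\<close>.\<close>
  define g :: "nat \<Rightarrow> bit ^ 'd" where "g i = (if i < d then axis (p i) 1 else (\<chi> j. 1))" for i
  define v where "v A = sum g A" for A
  define s where "s A = of_nat (card A) + (\<Sum>j\<in>UNIV. f (v A) $ j)" for A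
  \<comment> \<open>A vertex of the target has two antipodal lifts to the cube of dimension \<open>e + 1\<close>;
    \<open>F A\<close> is the one whose weight has the parity of \<open>card A\<close>.\<close>
  define F where "F A l = (if l = e then s A else f (v A) $ q l + s A)" for A l
  have s_e: "(of_nat e :: bit) = 0"
    using even by (auto simp: e_def elim: evenE)
  have edge: "\<exists>l<Suc e. \<forall>l'<Suc e. F (insert i A) l' = F A l' + of_bool (l = l')"
    if A: "A \<subseteq> {..<Suc d}" "i < Suc d" "i \<notin> A" for A i
  proof -
    have fin: "finite A"
      using A finite_subset by blast
    have "v (insert i A) - v A = g i"
      using A fin by (simp add: v_def)
    then have "projective_cube_adj (v (insert i A)) (v A)"
      by (auto simp: projective_cube_adj_def cayley_adj_def g_def)
    then have "projective_cube_adj (f (v (insert i A))) (f (v A))"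
      using hom by (auto simp: graph_hom_def)
    then consider j where "f (v (insert i A)) - f (v A) = axis j 1"
      | "f (v (insert i A)) - f (v A) = (\<chi> j. 1)"
      by (auto simp: projective_cube_adj_def cayley_adj_def)
    then show ?thesis
    proof cases
      case 1
      obtain l where l: "l < e" "q l = j"
        using q by (metis UNIV_I bij_betw_iff_bijections lessThan_iff)
      have fj: "f (v (insert i A)) = f (v A) + axis j 1"
        using 1 by (simp add: algebra_simps)
      have "s (insert i A) = s A"
        using A fin unfolding s_def fj
        by (simp add: sum.distrib axis_def)
      moreover have "q l' = j \<longleftrightarrow> l' = l" if "l' < e" for l'
        using q l that by (auto simp: bij_betw_def inj_on_def)
      ultimately have "F (insert i A) l' = F A l' + of_bool (l = l')" if "l' < Suc e" for l'
        using l that by (auto simp: F_def fj axis_def less_Suc_eq)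
      then show ?thesis
        using l by (intro exI[of _ l]) auto
    next
      case 2
      have fj: "f (v (insert i A)) = f (v A) + (\<chi> j. 1)"
        using 2 by (simp add: algebra_simps)
      \<comment> \<open>As \<open>e\<close> is even, the coordinate sum is unchanged. Below
        \<open>e\<close>, the changes of \<open>f\<close> and \<open>s\<close> then cancel in
        \<open>F\<close>.\<close>
      have "s (insert i A) = s A + 1"
        using A fin s_e unfolding s_def fj
        by (simp add: sum.distrib e_def)
      then have "F (insert i A) l' = F A l' + of_bool (e = l')" if "l' < Suc e" for l'
        using that by (auto simp: F_def fj)
      then show ?thesis
        by (intro exI[of _ e]) auto
    qed
  qed
  define L where "L A i = (SOME l. l < Suc e \<and> (\<forall>l'<Suc e. F (insert i A) l' = F A l' + of_bool (l = l')))"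
    for A i
  have L: "L A i < Suc e \<and> (\<forall>l'<Suc e. F (insert i A) l' = F A l' + of_bool (L A i = l'))"
    if "A \<subseteq> {..<Suc d}" "i < Suc d" "i \<notin> A" for A i
    unfolding L_def by (rule someI_ex[OF edge[OF that]])
  \<comment> \<open>It follows that complementary sets have the same image under
    \<open>v\<close>.\<close>
  have total: "v {..<Suc d} = 0"
  proof -
    have "(\<Sum>i<d. axis (p i) 1 :: bit ^ 'd) = (\<Sum>j\<in>UNIV. axis j 1)"
      by (rule sum.reindex_bij_betw[OF p])
    also have "\<dots> = (\<chi> j. 1)"
      by (simp add: vec_eq_iff axis_def)
    finally show ?thesis
      by (simp add: v_def g_def bit_vec_add_self)
  qed
  have anti: "F ({..<Suc d} - A) l = F A l + 1" if A: "A \<subseteq> {..<Suc d}" "l < Suc e" for A l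
  proof -
    have "v ({..<Suc d} - A) + v A = 0"
      unfolding total[symmetric] v_def using A by (intro sum.subset_diff[symmetric]) auto
    then have vv: "v ({..<Suc d} - A) = v A"
      by (metis bit_vec_diff eq_iff_diff_eq_0)
    have "card ({..<Suc d} - A) + card A = Suc d"
      using A by (metis card_lessThan card_mono card_Diff_subset finite_lessThan finite_subset le_add_diff_inverse2)
    \<comment> \<open>Evenness of \<open>d\<close> enters here: \<open>Suc d\<close> is odd.\<close>
    then have "odd (card ({..<Suc d} - A)) \<longleftrightarrow> even (card A)"
      using even by (metis d_def even_Suc even_add)
    then have "s ({..<Suc d} - A) = s A + 1"
      by (simp add: s_def vv of_nat_bit_odd)
    then show ?thesis
      by (auto simp: F_def vv)
  qed
  interpret antipodal_cube_map "Suc d" "Suc e" F L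
    using L anti by unfold_locales auto
  show ?thesis
  proof (rule surjI)
    fix y :: "bit ^ 'e"
    let ?P = "\<lambda>x. f x = y"
    \<comment> \<open>Of the two lifts of \<open>y\<close>, this one has \<open>s A = 0\<close>, so
      its coordinates below \<open>e\<close> are those of \<open>y\<close>.\<close>
    obtain A where A: "\<And>l. l < Suc e \<Longrightarrow> F A l = (if l = e then 0 else y $ q l)"
      using surjective[of "\<lambda>l. if l = e then 0 else y $ q l"] by blast
    have "f (v A) $ j = y $ j" for j
    proof -
      obtain l where "l < e" "q l = j"
        using q by (metis UNIV_I bij_betw_iff_bijections lessThan_iff)
      then show ?thesis
        using A[of l] A[of e] by (simp add: F_def)
    qed
    then have "?P (v A)"
      by (simp add: vec_eq_iff)
    then show "f (SOME x. ?P x) = y"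
      by (rule someI)
  qed
qed

theorem theorem15:
  fixes f :: "bit ^ 6 \<Rightarrow> bit ^ 4"
  assumes "graph_hom projective_cube_adj projective_cube_adj f"
  shows "surj f"
  using assms by (rule projective_cube_hom_surj) simp_all

end
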